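(* Assume Martin's Axiom for $\sigma$-centered posets. For an arbitrary tall summable ideal $\mathcal{I}_g$ there is an $\mathcal{I}_g$-ultrafilter (a nonprincipal ultrafilter on $\omega$) which is not rapid.
   Context: For $g:\omega\to(0,+\infty)$ with $\sum_n g(n)=+\infty$, $\mathcal{I}_g=\{A\subseteq\omega:\sum_{a\in A}g(a)<+\infty\}$; it is tall iff $g(n)\to0$. An ultrafilter $\mathcal{U}$ on $\omega$ is an $\mathcal{I}$-ultrafilter if for every $F:\omega\to\omega$ there is $A\in\mathcal{U}$ with $F[A]\in\mathcal{I}$. An ultrafilter $\mathcal{U}$ is rapid if the enumeration functions $e_A$ ($A\in\mathcal{U}$; $e_A$ the strictly increasing function from $\omega$ onto $A$) form a dominating family in $(\omega^\omega,\le^* )$. Martin's Axiom for $\sigma$-centered posets: for every $\sigma$-centered poset and fewer than $\mathfrak{c}$ dense subsets, some filter meets all of them. *)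

theory Defs
  imports "HOL-Analysis.Analysis" "HOL-Library.Equipollence"
begin

subsection \<open>Summable ideals\<close>

definition summable_ideal :: "(nat \<Rightarrow> real) \<Rightarrow> nat set set" where
  "summable_ideal g = {A. g summable_on A}"

definition tall :: "nat set set \<Rightarrow> bool" where
  "tall I \<longleftrightarrow> (\<forall>A. infinite A \<longrightarrow> (\<exists>B\<in>I. B \<subseteq> A \<and> infinite B))"

lemma tall_summable_ideal_iff:
  assumes pos: "\<And>n. g n > 0"
  shows "tall (summable_ideal g) \<longleftrightarrow> g \<longlonglongrightarrow> 0"
proof
  assume t: "tall (summable_ideal g)"
  show "g \<longlonglongrightarrow> 0"
  proof (rule ccontr)
    assume "\<not> g \<longlonglongrightarrow> 0"
    then obtain e where e: "e > 0" and frq: "\<forall>N. \<exists>n\<ge>N. e \<le> g n"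
      using pos by (auto simp: LIMSEQ_iff not_less abs_of_pos)
    have "infinite {n. e \<le> g n}"
      using frq by (auto simp: infinite_nat_iff_unbounded_le)
    with t obtain B where B: "g summable_on B" "B \<subseteq> {n. e \<le> g n}" "infinite B"
      unfolding tall_def summable_ideal_def by blast
    obtain n :: nat where n: "infsum g B < real n * e"
      using e reals_Archimedean3 by blast
    obtain F where F: "F \<subseteq> B" "finite F" "card F = n"
      using infinite_arbitrarily_large[OF B(3)] by blast
    have "real n * e \<le> sum g F"
      using sum_bounded_below[of F e g] F B(2) by auto
    also have "\<dots> \<le> infsum g B"
      by (rule finite_sum_le_infsum) (use B(1) F pos in \<open>auto simp: less_imp_le\<close>)
    finally show False
      using n by simp
  qed
next
  assume lim: "g \<longlonglongrightarrow> 0"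
  show "tall (summable_ideal g)"
    unfolding tall_def
  proof (intro allI impI)
    fix A :: "nat set" assume A: "infinite A"
    have ev: "\<exists>n\<in>A. n > m \<and> g n < (1/2)^k" for m k :: nat
    proof -
      obtain N where N: "\<And>n. n \<ge> N \<Longrightarrow> g n < (1/2)^k"
        using order_tendstoD(2)[OF lim, of "(1/2)^k"] by (auto simp: eventually_sequentially)
      obtain n where "n \<in> A" "n > max m N"
        using A by (meson infinite_nat_iff_unbounded)
      with N show ?thesis by (auto intro!: bexI[of _ n])
    qed
    obtain h where h: "\<And>k. h k \<in> A \<and> g (h k) < (1/2)^k \<and> h k < h (Suc k)"
      using dependent_nat_choice[of "\<lambda>k n. n \<in> A \<and> g n < (1/2)^k" "\<lambda>k m n. m < n"] ev
      by (metis (no_types, lifting))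
    have inj: "inj h"
      using h by (meson strict_mono_Suc_iff strict_mono_imp_inj_on)
    have "summable (\<lambda>k. g (h k))"
      by (rule summable_comparison_test'[OF summable_geometric[of "1/2"], where N = 0])
         (use h pos in \<open>auto intro!: less_imp_le simp: abs_of_pos\<close>)
    then have "(g \<circ> h) summable_on UNIV"
      using pos by (intro summable_nonneg_imp_summable_on) (auto simp: o_def less_imp_le)
    then have "range h \<in> summable_ideal g"
      using inj by (simp add: summable_ideal_def summable_on_reindex)
    moreover have "range h \<subseteq> A" "infinite (range h)"
      using h inj by (auto simp: finite_image_iff)
    ultimately show "\<exists>B\<in>summable_ideal g. B \<subseteq> A \<and> infinite B"
      by blast
  qed
qed

subsection \<open>Ultrafilters\<close>

definition filter_sets :: "'a filter \<Rightarrow> 'a set set" where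
  "filter_sets U = {A. eventually (\<lambda>x. x \<in> A) U}"

definition ultrafilter :: "'a filter \<Rightarrow> bool" where
  "ultrafilter U \<longleftrightarrow> U \<noteq> bot \<and> (\<forall>A. A \<in> filter_sets U \<or> - A \<in> filter_sets U)"

definition nonprincipal :: "'a filter \<Rightarrow> bool" where
  "nonprincipal U \<longleftrightarrow> (\<forall>x. {x} \<notin> filter_sets U)"

definition ideal_ultrafilter :: "nat set set \<Rightarrow> nat filter \<Rightarrow> bool" where
  "ideal_ultrafilter I U \<longleftrightarrow>
     ultrafilter U \<and> (\<forall>F :: nat \<Rightarrow> nat. \<exists>A\<in>filter_sets U. F ` A \<in> I)"

definition dominating :: "(nat \<Rightarrow> nat) set \<Rightarrow> bool" where
  "dominating H \<longleftrightarrow> (\<forall>f. \<exists>h\<in>H. \<forall>\<^sub>F n in sequentially. f n \<le> h n)"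

text \<open>\<^const>\<open>enumerate\<close> is the increasing enumeration only for infinite sets, hence the guard;
  it is redundant for nonprincipal ultrafilters, all of whose members are infinite.\<close>

definition rapid :: "nat filter \<Rightarrow> bool" where
  "rapid U \<longleftrightarrow> dominating {enumerate A |A. A \<in> filter_sets U \<and> infinite A}"

subsection \<open>Martin's Axiom for \<open>\<sigma>\<close>-centered posets\<close>

text \<open>A poset is a carrier \<open>P\<close> with a relation \<open>r\<close>, where \<open>(p, q) \<in> r\<close> means \<open>p \<le> q\<close>,
  that is, \<open>p\<close> is the stronger condition.\<close>

definition centered :: "'p set \<Rightarrow> 'p rel \<Rightarrow> 'p set \<Rightarrow> bool" where
  "centered P r C \<longleftrightarrow>
     C \<subseteq> P \<and> (\<forall>F. finite F \<and> F \<subseteq> C \<longrightarrow> (\<exists>q\<in>P. \<forall>p\<in>F. (q, p) \<in> r))"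

definition sigma_centered :: "'p set \<Rightarrow> 'p rel \<Rightarrow> bool" where
  "sigma_centered P r \<longleftrightarrow>
     (\<exists>C :: nat \<Rightarrow> 'p set. P = (\<Union>n. C n) \<and> (\<forall>n. centered P r (C n)))"

definition poset_dense :: "'p set \<Rightarrow> 'p rel \<Rightarrow> 'p set \<Rightarrow> bool" where
  "poset_dense P r D \<longleftrightarrow> D \<subseteq> P \<and> (\<forall>p\<in>P. \<exists>d\<in>D. (d, p) \<in> r)"

definition poset_filter :: "'p set \<Rightarrow> 'p rel \<Rightarrow> 'p set \<Rightarrow> bool" where
  "poset_filter P r G \<longleftrightarrow>
     G \<subseteq> P \<and> G \<noteq> {} \<and>
     (\<forall>p\<in>G. \<forall>q\<in>P. (p, q) \<in> r \<longrightarrow> q \<in> G) \<and>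
     (\<forall>p\<in>G. \<forall>q\<in>G. \<exists>s\<in>G. (s, p) \<in> r \<and> (s, q) \<in> r)"

text \<open>HOL cannot quantify over all types inside a formula, so the posets range over all those
  with carrier a set of reals; up to isomorphism these are exactly the posets of cardinality
  at most the continuum. This is an instance of the axiom for arbitrary posets, and implies it by the usual
  Loewenheim-Skolem argument. As an assumption it is therefore no stronger than the full
  axiom.\<close>

definition MA_sigma_centered :: bool where
  "MA_sigma_centered \<longleftrightarrow>
     (\<forall>(P :: real set) r \<D>.
        P \<noteq> {} \<and> partial_order_on P r \<and> sigma_centered P r \<and>
        (\<forall>D\<in>\<D>. poset_dense P r D) \<and> \<D> \<prec> (UNIV :: real set) \<longrightarrow>
        (\<exists>G. poset_filter P r G \<and> (\<forall>D\<in>\<D>. G \<inter> D \<noteq> {})))"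

end

theory Submission
  imports Defs
begin

text \<open>
  Call a set large if for every \<open>c\<close> it has, for arbitrarily large \<open>k\<close>, at least
  \<open>level g k c\<close> elements below \<open>level g k k\<close>. The non-large sets form an ideal,
  and no large set has an enumeration dominating \<open>\<lambda>k. level g k k\<close>, so an ultrafilter of
  large sets is not rapid. The levels grow so fast in \<open>c\<close> that, for every \<open>F\<close>,
  any \<open>level g k (Suc c)\<close> points contain \<open>level g k c\<close> points on which \<open>F\<close>
  is constant or whose image has \<open>g\<close>-mass at most \<open>1 / (k + 1)\<close>.

  Hence a filter base of fewer than continuum many large sets can be extended by a set \<open>A\<close>
  with \<open>F ` A\<close> in the summable ideal: if no fibre of \<open>F\<close> is compatible with the
  base, force with the finite sets whose image has mass less than 1. This poset is
  countable, so a generic set is provided by Martin's Axiom. A recursion of length continuum over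
  all \<open>F\<close> yields the ultrafilter.
\<close>

unbundle cardinal_syntax

subsection \<open>Cardinalities\<close>

lemma lepoll_iff_ordLeq: "A \<lesssim> B \<longleftrightarrow> |A| \<le>o |B|"
  by (simp add: lepoll_def card_of_ordLeq)

lemma ordLess_imp_lesspoll: "|A| <o |B| \<Longrightarrow> A \<prec> B"
  by (simp add: lesspoll_def lepoll_iff_ordLeq eqpoll_iff_card_of_ordIso
      not_ordLess_ordIso ordLess_imp_ordLeq)

lemma Times_lepoll_infinite:
  assumes "infinite X" "A \<lesssim> X" "B \<lesssim> X"
  shows "A \<times> B \<lesssim> X"
  using card_of_Sigma_ordLeq_infinite[of X A "\<lambda>_. B"] assms
  by (simp add: lepoll_iff_ordLeq)

text \<open>An infinite set absorbs products, so by induction on \<open>n\<close> its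
  \<open>n\<close>-element subsets are no more numerous than its points; it also absorbs the union
  over all \<open>n\<close>.\<close>

lemma Fpow_lepoll_infinite:
  assumes "infinite X"
  shows "Fpow X \<lesssim> X"
proof -
  have *: "{K. finite K \<and> K \<subseteq> X \<and> card K = n} \<lesssim> X" for n
  proof (induction n)
    case 0
    have empty: "{K. finite K \<and> K \<subseteq> X \<and> card K = 0} = {{}}"
      by auto
    show ?case
      unfolding empty by (rule finite_lepoll_infinite) (use assms in auto)
  next
    case (Suc n)
    have "{K. finite K \<and> K \<subseteq> X \<and> card K = Suc n}
        \<subseteq> (\<lambda>(x, K). insert x K) ` (X \<times> {K. finite K \<and> K \<subseteq> X \<and> card K = n})"
    proof
      fix K assume K: "K \<in> {K. finite K \<and> K \<subseteq> X \<and> card K = Suc n}"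
      then obtain x L where "K = insert x L" "x \<notin> L" "card L = n"
        by (auto simp: card_Suc_eq)
      with K show "K \<in> (\<lambda>(x, K). insert x K) ` (X \<times> {K. finite K \<and> K \<subseteq> X \<and> card K = n})"
        by (intro image_eqI[of _ _ "(x, L)"]) auto
    qed
    then show ?case
      by (rule lepoll_trans[OF subset_image_lepoll Times_lepoll_infinite[OF assms lepoll_refl Suc]])
  qed
  have Fpow_eq: "Fpow X = (\<Union>n. {K. finite K \<and> K \<subseteq> X \<and> card K = n})"
    by (auto simp: Fpow_def)
  have "|UNIV :: nat set| \<le>o |X|"
    using assms by (simp add: infinite_le_lepoll lepoll_iff_ordLeq)
  then show ?thesis
    unfolding lepoll_iff_ordLeq Fpow_eq
    by (rule card_of_UNION_ordLeq_infinite[OF assms]) (use * in \<open>simp add: lepoll_iff_ordLeq\<close>)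
qed

lemma countable_lesspoll_uncountable:
  assumes "countable Y" "uncountable R"
  shows "Y \<prec> R"
proof -
  have "Y \<lesssim> (UNIV :: nat set)"
    using assms(1) by (auto simp: countable_def lepoll_def)
  also have "\<dots> \<lesssim> R"
    using assms(2) by (meson countable_finite infinite_le_lepoll)
  finally show ?thesis
    using assms by (meson countable_eqpoll eqpoll_sym lesspoll_def)
qed

lemma Fpow_lesspoll_uncountable:
  assumes "X \<prec> R" "uncountable R"
  shows "Fpow X \<prec> R"
proof (cases "finite X")
  case True
  then show ?thesis
    using assms(2) by (intro countable_lesspoll_uncountable countable_Fpow countable_finite)
next
  case False
  then show ?thesis
    by (rule lesspoll_trans1[OF Fpow_lepoll_infinite assms(1)])
qed

lemma Times_nat_lesspoll_uncountable:
  assumes "X \<prec> R" "uncountable R"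
  shows "X \<times> (UNIV :: nat set) \<prec> R"
proof (cases "finite X")
  case True
  then show ?thesis
    using assms(2) by (intro countable_lesspoll_uncountable) (auto intro: countable_finite)
next
  case False
  then have "X \<times> (UNIV :: nat set) \<lesssim> X"
    by (intro Times_lepoll_infinite) (auto simp: infinite_le_lepoll)
  then show ?thesis
    by (rule lesspoll_trans1[OF _ assms(1)])
qed

text \<open>A function is coded by its graph, which \<open>prod_encode\<close> turns into a set of
  naturals.\<close>

lemma nat_fun_lepoll_real: "(UNIV :: (nat \<Rightarrow> nat) set) \<lesssim> (UNIV :: real set)"
proof -
  have "inj (\<lambda>F :: nat \<Rightarrow> nat. prod_encode ` {(n, F n) |n. True})"
  proof (rule injI)
    fix F G :: "nat \<Rightarrow> nat"
    assume "prod_encode ` {(n, F n) |n. True} = prod_encode ` {(n, G n) |n. True}"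
    then have "{(n, F n) |n. True} = {(n, G n) |n. True}"
      by (simp add: inj_image_eq_iff inj_prod_encode)
    then show "F = G"
      by fastforce
  qed
  then have "(UNIV :: (nat \<Rightarrow> nat) set) \<lesssim> (UNIV :: nat set set)"
    by (auto simp: lepoll_def)
  then show ?thesis
    by (rule lepoll_trans2[OF _ nat_sets_eqpoll_reals])
qed

subsection \<open>Martin's Axiom for countable families of sets ordered by reverse inclusion\<close>

text \<open>Carries the axiom over from posets of reals to countable families of sets in which a
  larger set is a stronger condition. A countable poset is \<sigma>-centered because it is a
  countable union of singletons.\<close>

lemma MA_countable_family:
  fixes S :: "'a set set" and \<D> :: "'a set set set"
  assumes MA: "MA_sigma_centered"
    and S: "countable S" "S \<noteq> {}"
    and dense: "\<And>D s. D \<in> \<D> \<Longrightarrow> s \<in> S \<Longrightarrow> \<exists>t\<in>D. s \<subseteq> t"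
    and sub: "\<And>D. D \<in> \<D> \<Longrightarrow> D \<subseteq> S"
    and small: "\<D> \<prec> (UNIV :: real set)"
  obtains G where "G \<subseteq> S" "G \<noteq> {}"
    "\<And>s t. s \<in> G \<Longrightarrow> t \<in> G \<Longrightarrow> \<exists>u\<in>G. s \<subseteq> u \<and> t \<subseteq> u"
    "\<And>D. D \<in> \<D> \<Longrightarrow> G \<inter> D \<noteq> {}"
proof -
  define e :: "'a set \<Rightarrow> real" where "e = (\<lambda>s. real (to_nat_on S s))"
  have inj: "inj_on e S"
    using S(1) by (auto simp: e_def inj_on_def)
  define P where "P = e ` S"
  define r where "r = {(p, q). p \<in> P \<and> q \<in> P \<and> inv_into S e q \<subseteq> inv_into S e p}"
  have r_iff: "(e s, e t) \<in> r \<longleftrightarrow> t \<subseteq> s" if "s \<in> S" "t \<in> S" for s t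
    using that inj by (simp add: r_def P_def)
  have "partial_order_on P r"
    unfolding partial_order_on_def preorder_on_def
  proof (intro conjI)
    show "r \<subseteq> P \<times> P" "refl_on P r"
      by (auto simp: r_def refl_on_def)
    show "trans r"
      by (auto simp: r_def trans_def)
    show "antisym r"
      by (auto simp: r_def antisym_def P_def inj)
  qed
  moreover have "sigma_centered P r"
    unfolding sigma_centered_def
  proof (intro exI conjI allI)
    \<comment> \<open>Each piece is empty or a singleton, whose element is its own lower bound. For
      an empty piece, the empty subset still asks for some element of \<open>P\<close>.\<close>
    show "P = (\<Union>n. {p \<in> P. p = real n})"
      by (auto simp: P_def e_def)
    show "centered P r {p \<in> P. p = real n}" for n
    proof (cases "real n \<in> P")
      case True
      then show ?thesis
        by (auto simp: centered_def r_def)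
    next
      case False
      moreover have "P \<noteq> {}"
        using S(2) by (simp add: P_def)
      ultimately show ?thesis
        by (auto simp: centered_def)
    qed
  qed
  moreover have "\<forall>D\<in>(`) e ` \<D>. poset_dense P r D"
  proof
    fix D' assume "D' \<in> (`) e ` \<D>"
    then obtain D where D: "D \<in> \<D>" "D' = e ` D"
      by blast
    show "poset_dense P r D'"
      unfolding poset_dense_def
    proof (intro conjI ballI)
      show "D' \<subseteq> P"
        using D sub by (auto simp: P_def)
      fix p assume "p \<in> P"
      then obtain s where s: "s \<in> S" "p = e s"
        by (auto simp: P_def)
      with dense D obtain t where "t \<in> D" "s \<subseteq> t"
        by blast
      then show "\<exists>d\<in>D'. (d, p) \<in> r"
        using D s sub r_iff by blast
    qed
  qed
  moreover have "(`) e ` \<D> \<prec> (UNIV :: real set)"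
    by (rule lesspoll_trans1[OF image_lepoll small])
  moreover have "P \<noteq> {}"
    using S(2) by (simp add: P_def)
  ultimately obtain H where H: "poset_filter P r H" "\<And>D. D \<in> \<D> \<Longrightarrow> H \<inter> e ` D \<noteq> {}"
    using MA unfolding MA_sigma_centered_def by (metis imageI)
  define G where "G = {s \<in> S. e s \<in> H}"
  have HP: "H \<subseteq> P" "H \<noteq> {}"
    using H(1) by (auto simp: poset_filter_def)
  show thesis
  proof
    show "G \<subseteq> S" "G \<noteq> {}"
      using HP by (auto simp: G_def P_def)
    show "G \<inter> D \<noteq> {}" if "D \<in> \<D>" for D
      using H(2)[OF that] sub[OF that] by (auto simp: G_def)
    fix s t assume st: "s \<in> G" "t \<in> G"
    then obtain q where q: "q \<in> H" "(q, e s) \<in> r" "(q, e t) \<in> r"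
      using H(1) unfolding poset_filter_def G_def by blast
    moreover obtain u where "u \<in> S" "q = e u"
      using q HP by (auto simp: P_def)
    ultimately show "\<exists>u\<in>G. s \<subseteq> u \<and> t \<subseteq> u"
      using st r_iff by (auto simp: G_def)
  qed
qed

subsection \<open>Large sets\<close>

lemma finite_ge_of_tendsto_0:
  fixes g :: "nat \<Rightarrow> real"
  assumes "g \<longlonglongrightarrow> 0" "\<delta> > 0"
  shows "finite {v. g v \<ge> \<delta>}"
proof -
  obtain N where "\<And>n. n \<ge> N \<Longrightarrow> g n < \<delta>"
    using order_tendstoD(2)[OF assms] by (auto simp: eventually_sequentially)
  then have "{v. g v \<ge> \<delta>} \<subseteq> {..<N}"
    by (force simp: not_less[symmetric])
  then show ?thesis
    using finite_subset by blast
qed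

text \<open>Pigeonhole: if all fibres of \<open>F\<close> on \<open>T\<close> have fewer than
  \<open>m\<close> points, then \<open>F\<close> takes at least
  \<open>m + card {v. g v \<ge> \<delta>}\<close> values. Discarding the heavy ones leaves
  \<open>m\<close> values of mass below \<open>\<delta>\<close>; \<open>t\<close> picks one preimage
  of each.\<close>

lemma homogeneous_subset:
  fixes g :: "nat \<Rightarrow> real" and F :: "nat \<Rightarrow> nat"
  assumes fin: "finite {v. g v \<ge> \<delta>}" and T: "finite T"
    and card_T: "m * (m + card {v. g v \<ge> \<delta>}) \<le> card T" and m: "m > 0"
  obtains t where "t \<subseteq> T" "m \<le> card t" "(\<exists>v. F ` t = {v}) \<or> sum g (F ` t) \<le> real m * \<delta>"
proof (cases "\<exists>v. m \<le> card {x \<in> T. F x = v}")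
  case True
  then obtain v where v: "m \<le> card {x \<in> T. F x = v}" by blast
  then have "{x \<in> T. F x = v} \<noteq> {}"
    using m by (metis card.empty le_zero_eq less_irrefl)
  then have "F ` {x \<in> T. F x = v} = {v}"
    by auto
  then show ?thesis
    using that[of "{x \<in> T. F x = v}"] v by blast
next
  case False
  have "card T = (\<Sum>v\<in>F ` T. card {x \<in> T. F x = v})"
    unfolding card_eq_sum by (rule sum.image_gen[OF T])
  also have "\<dots> \<le> card (F ` T) * m"
    using sum_bounded_above[of "F ` T" "\<lambda>v. card {x \<in> T. F x = v}" m] False
    by (simp add: not_le less_imp_le)
  finally have "m + card {v. g v \<ge> \<delta>} \<le> card (F ` T)"
    using card_T m by (metis le_trans mult.commute mult_le_cancel1)
  then have "m \<le> card (F ` T - {v. g v \<ge> \<delta>})"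
    using diff_card_le_card_Diff[OF fin, of "F ` T"] by linarith
  then obtain W where W: "W \<subseteq> F ` T - {v. g v \<ge> \<delta>}" "card W = m"
    by (meson obtain_subset_with_card_n)
  define t where "t = inv_into T F ` W"
  have Ft: "F ` t = W"
    using W(1) by (force simp: t_def image_image f_inv_into_f subset_iff image_iff)
  have "finite t"
    unfolding t_def using W(1) T by (meson finite_Diff finite_imageI finite_subset)
  then have "m \<le> card t"
    using card_image_le[of t F] Ft W(2) by simp
  moreover have "t \<subseteq> T"
    using W(1) by (auto simp: t_def intro: inv_into_into)
  moreover have "sum g W \<le> real m * \<delta>"
    using sum_bounded_above[of W g \<delta>] W by force
  ultimately show ?thesis
    using that[of t] Ft by blast
qed

text \<open>The recursion meets the bound of \<open>homogeneous_subset\<close> for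
  \<open>m = level g k c\<close> and \<open>\<delta> = 1 / ((k + 1) * m)\<close>, so that
  \<open>m * \<delta> = 1 / (k + 1)\<close>. The summand 2 makes doubling immediate, and the start
  \<open>k + 2\<close> keeps all levels above \<open>k + 1\<close>. The counted set is finite when
  \<open>g\<close> tends to 0; otherwise \<open>card\<close> may take its default value 0.\<close>

primrec level :: "(nat \<Rightarrow> real) \<Rightarrow> nat \<Rightarrow> nat \<Rightarrow> nat" where
  "level g k 0 = k + 2"
| "level g k (Suc c) = level g k c *
     (level g k c + 2 + card {v. g v \<ge> 1 / (real (Suc k) * real (level g k c))})"

lemma level_gt: "k + 1 < level g k c"
proof (induction c)
  case (Suc c)
  have "level g k c * 1 \<le> level g k (Suc c)"
    unfolding level.simps by (rule mult_le_mono2) simp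
  with Suc show ?case by linarith
qed simp

lemma level_double: "2 * level g k c \<le> level g k (Suc c)"
  by simp

lemma level_mono: "c \<le> d \<Longrightarrow> level g k c \<le> level g k d"
  by (rule lift_Suc_mono_le[of "level g k"]) (use level_double[of g k] in \<open>auto intro: le_trans[rotated]\<close>)

text \<open>Raising \<open>c\<close> demands a larger \<open>k\<close> and a higher level at once,
  so one parameter serves for both.\<close>

definition large :: "(nat \<Rightarrow> real) \<Rightarrow> nat set \<Rightarrow> bool" where
  "large g A \<longleftrightarrow> (\<forall>c. \<exists>k\<ge>c. level g k c \<le> card (A \<inter> {..<level g k k}))"

lemma largeE:
  assumes "large g A"
  obtains k where "k \<ge> c" "level g k c \<le> card (A \<inter> {..<level g k k})"
  using assms unfolding large_def by blast

lemma not_largeE: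
  assumes "\<not> large g A"
  obtains c where "\<And>k. k \<ge> c \<Longrightarrow> card (A \<inter> {..<level g k k}) < level g k c"
proof -
  from assms obtain c where "\<not> (\<exists>k\<ge>c. level g k c \<le> card (A \<inter> {..<level g k k}))"
    unfolding large_def by blast
  then show ?thesis
    using that[of c] not_le by blast
qed

lemma large_UNIV: "large g UNIV"
  by (auto simp: large_def intro!: exI level_mono)

lemma large_mono:
  assumes "large g A" "A \<subseteq> B"
  shows "large g B"
  unfolding large_def
proof
  fix c
  obtain k where k: "k \<ge> c" "level g k c \<le> card (A \<inter> {..<level g k k})"
    using largeE[OF assms(1)] by blast
  have "card (A \<inter> {..<level g k k}) \<le> card (B \<inter> {..<level g k k})"
    using assms(2) by (intro card_mono) auto
  with k show "\<exists>k\<ge>c. level g k c \<le> card (B \<inter> {..<level g k k})"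
    by (meson le_trans)
qed

text \<open>If from some \<open>k\<close> on \<open>A\<close> stays below level \<open>a\<close> and
  \<open>B\<close> below level \<open>b\<close>, their union stays below level
  \<open>max a b + 1\<close>, because levels at least double.\<close>

lemma large_Un:
  assumes "large g (A \<union> B)"
  shows "large g A \<or> large g B"
proof (rule ccontr)
  assume "\<not> ?thesis"
  then have "\<not> large g A" "\<not> large g B"
    by auto
  obtain a where a: "\<And>k. k \<ge> a \<Longrightarrow> card (A \<inter> {..<level g k k}) < level g k a"
    using not_largeE[OF \<open>\<not> large g A\<close>] by blast
  obtain b where b: "\<And>k. k \<ge> b \<Longrightarrow> card (B \<inter> {..<level g k k}) < level g k b"
    using not_largeE[OF \<open>\<not> large g B\<close>] by blast
  obtain k where k: "k \<ge> Suc (max a b)"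
    "level g k (Suc (max a b)) \<le> card ((A \<union> B) \<inter> {..<level g k k})"
    using largeE[OF assms] by blast
  have "card ((A \<union> B) \<inter> {..<level g k k})
      \<le> card (A \<inter> {..<level g k k}) + card (B \<inter> {..<level g k k})"
    by (simp add: Int_Un_distrib2 card_Un_le)
  also have "\<dots> < level g k a + level g k b"
    using a[of k] b[of k] k(1) by linarith
  also have "\<dots> \<le> 2 * level g k (max a b)"
    using level_mono[of a "max a b" g k] level_mono[of b "max a b" g k] by simp
  also have "\<dots> \<le> level g k (Suc (max a b))"
    by (rule level_double)
  finally show False
    using k(2) by simp
qed

lemma not_large_singleton: "\<not> large g {x}"
proof
  assume "large g {x}"
  then obtain k where "level g k 0 \<le> card ({x} \<inter> {..<level g k k})"
    by (rule largeE)
  also have "\<dots> \<le> card {x}"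
    by (intro card_mono) auto
  finally show False by simp
qed

lemma not_large_empty: "\<not> large g {}"
  using large_mono not_large_singleton by blast

text \<open>Where the enumeration is at least \<open>level g k k\<close>, the elements of
  \<open>A\<close> below that bound are among its first \<open>k\<close>, whereas every level
  exceeds \<open>k\<close>.\<close>

lemma large_not_dominating:
  assumes "large g A" "infinite A"
  shows "\<not> (\<forall>\<^sub>F k in sequentially. level g k k \<le> enumerate A k)"
proof
  assume "\<forall>\<^sub>F k in sequentially. level g k k \<le> enumerate A k"
  then obtain N where N: "\<And>k. k \<ge> N \<Longrightarrow> level g k k \<le> enumerate A k"
    by (auto simp: eventually_sequentially)
  obtain k where k: "k \<ge> N" "level g k N \<le> card (A \<inter> {..<level g k k})"
    using largeE[OF assms(1)] by blast
  have "A \<inter> {..<level g k k} \<subseteq> enumerate A ` {..<k}"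
  proof
    fix x assume x: "x \<in> A \<inter> {..<level g k k}"
    then obtain n where n: "enumerate A n = x"
      using assms(2) enumerate_Ex by blast
    then have "enumerate A n < enumerate A k"
      using x N[OF k(1)] by simp
    then show "x \<in> enumerate A ` {..<k}"
      using n assms(2) by auto
  qed
  then have "card (A \<inter> {..<level g k k}) \<le> card {..<k}"
    by (meson card_image_le card_mono finite_imageI finite_lessThan le_trans)
  then show False
    using k(2) level_gt[of k g N] by simp
qed

subsection \<open>Extending a filter base\<close>

text \<open>Removing the points with values of mass at least \<open>\<sigma>\<close> settles the
  case where \<open>F\<close> is constant on the homogeneous set; otherwise the image has mass at
  most \<open>1 / (k + 1)\<close>, which is small for large \<open>k\<close>.\<close>

lemma small_image_in_large_set:
  fixes g :: "nat \<Rightarrow> real" and F :: "nat \<Rightarrow> nat"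
  assumes lim: "g \<longlonglongrightarrow> 0" and \<sigma>: "\<sigma> > 0"
    and large: "large g (B - F -` {v. g v \<ge> \<sigma>})"
  obtains t k where "finite t" "t \<subseteq> B \<inter> {..<level g k k}" "k \<ge> c" "level g k c \<le> card t"
    "sum g (F ` t) < \<sigma>"
proof -
  obtain n :: nat where n: "n > 0" "1 / real n < \<sigma>"
    using \<sigma> by (metis nat_approx_posE zero_less_Suc)
  define B' where "B' = B - F -` {v. g v \<ge> \<sigma>}"
  \<comment> \<open>Passing to a homogeneous subset costs one level, hence the successor;
    \<open>c\<close> secures the size and \<open>n\<close> the bound
    \<open>1 / (k + 1) < \<sigma>\<close>.\<close>
  obtain k where k: "k \<ge> Suc (max c n)"
    "level g k (Suc (max c n)) \<le> card (B' \<inter> {..<level g k k})"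
    using largeE[OF large] unfolding B'_def by blast
  define m where "m = level g k (max c n)"
  define \<delta> where "\<delta> = 1 / (real (Suc k) * real m)"
  have m: "m > 0"
    using level_gt[of k g "max c n"] by (simp add: m_def)
  have "m * (m + card {v. g v \<ge> \<delta>}) \<le> level g k (Suc (max c n))"
    by (simp add: m_def \<delta>_def)
  with k(2) have card: "m * (m + card {v. g v \<ge> \<delta>}) \<le> card (B' \<inter> {..<level g k k})"
    by linarith
  have \<delta>: "\<delta> > 0"
    using m by (simp add: \<delta>_def)
  obtain t where t: "t \<subseteq> B' \<inter> {..<level g k k}" "m \<le> card t"
    "(\<exists>v. F ` t = {v}) \<or> sum g (F ` t) \<le> real m * \<delta>"
    by (rule homogeneous_subset[OF finite_ge_of_tendsto_0[OF lim \<delta>] _ card m, where F = F]) simp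
  have "sum g (F ` t) < \<sigma>"
    using t(3)
  proof
    assume "\<exists>v. F ` t = {v}"
    then obtain v x where v: "F ` t = {v}" "x \<in> t" "v = F x"
      by blast
    then have "g v < \<sigma>"
      using t(1) by (auto simp: B'_def)
    with v(1) show ?thesis
      by simp
  next
    assume "sum g (F ` t) \<le> real m * \<delta>"
    also have "\<dots> = 1 / real (Suc k)"
      using m by (simp add: \<delta>_def)
    also have "\<dots> \<le> 1 / real n"
      using k(1) n(1) by (intro divide_left_mono) auto
    finally show ?thesis
      using n(2) by simp
  qed
  moreover have "level g k c \<le> card t"
    using t(2) level_mono[of c "max c n" g k] by (simp add: m_def)
  moreover have "finite t"
    using t(1) finite_subset by blast
  moreover have "t \<subseteq> B \<inter> {..<level g k k}" "k \<ge> c"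
    using t(1) k(1) by (auto simp: B'_def)
  ultimately show ?thesis
    by (intro that)
qed

lemma summable_ideal_image_of_fibre:
  "F ` (F -` {v}) \<in> summable_ideal g"
  unfolding summable_ideal_def
  by (auto intro!: summable_on_finite intro: finite_subset[of _ "{v}"])

lemma generic_small_image:
  fixes g :: "nat \<Rightarrow> real" and F :: "nat \<Rightarrow> nat" and \<B> :: "nat set set"
  assumes MA: "MA_sigma_centered" and pos: "\<And>n. g n > 0" and lim: "g \<longlonglongrightarrow> 0"
    and small: "\<B> \<prec> (UNIV :: real set)"
    and large: "\<And>B K. B \<in> \<B> \<Longrightarrow> finite K \<Longrightarrow> large g (B - F -` K)"
  obtains A where "F ` A \<in> summable_ideal g" "\<And>B. B \<in> \<B> \<Longrightarrow> large g (A \<inter> B)"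
proof -
  define S where "S = {s. finite s \<and> sum g (F ` s) < 1}"
  \<comment> \<open>The conditions in \<open>D (B, c)\<close> already witness the instance
    \<open>c\<close> of largeness on \<open>B\<close>; this persists in every larger set.\<close>
  define D where "D = (\<lambda>(B, c). {s \<in> S. \<exists>k\<ge>c. level g k c \<le> card (s \<inter> B \<inter> {..<level g k k})})"
  have S: "countable S"
    by (rule countable_subset[of _ "Collect finite"]) (auto simp: S_def countable_Collect_finite)
  have "{} \<in> S"
    by (simp add: S_def)
  then have S': "S \<noteq> {}"
    by blast
  have dense: "\<exists>t\<in>D'. s \<subseteq> t" if D'_in: "D' \<in> D ` (\<B> \<times> UNIV)" and s_in: "s \<in> S" for D' s
  proof -
    obtain B c where D': "B \<in> \<B>" "D' = D (B, c)"
      using D'_in by blast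
    have s: "finite s" "1 - sum g (F ` s) > 0"
      using s_in by (auto simp: S_def)
    \<comment> \<open>The mass still available to \<open>s\<close> serves as
      \<open>\<sigma>\<close>. Only finitely many values are that heavy, so \<open>large\<close>
      applies to their preimage.\<close>
    obtain t k where t: "finite t" "t \<subseteq> B \<inter> {..<level g k k}" "k \<ge> c" "level g k c \<le> card t"
      "sum g (F ` t) < 1 - sum g (F ` s)"
      by (rule small_image_in_large_set[OF lim s(2)
            large[OF D'(1) finite_ge_of_tendsto_0[OF lim s(2)]]])
    have "sum g (F ` (s \<union> t)) \<le> sum g (F ` s) + sum g (F ` t)"
      using sum.union_inter[of "F ` s" "F ` t" g] s(1) t(1) sum_nonneg[of "F ` s \<inter> F ` t" g] pos
      by (simp add: image_Un less_imp_le)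
    then have "s \<union> t \<in> S"
      using s(1) t by (simp add: S_def)
    moreover have "card t \<le> card ((s \<union> t) \<inter> B \<inter> {..<level g k k})"
      using t(2) by (intro card_mono) auto
    ultimately have "s \<union> t \<in> D'"
      unfolding D' D_def using t(3,4) by (auto intro: le_trans)
    then show ?thesis by blast
  qed
  have sub: "D' \<subseteq> S" if "D' \<in> D ` (\<B> \<times> UNIV)" for D'
    using that by (auto simp: D_def)
  have few: "D ` (\<B> \<times> UNIV) \<prec> (UNIV :: real set)"
    by (rule lesspoll_trans1[OF image_lepoll
          Times_nat_lesspoll_uncountable[OF small uncountable_UNIV_real]])
  obtain G where G: "G \<subseteq> S" "G \<noteq> {}"
    "\<And>s t. s \<in> G \<Longrightarrow> t \<in> G \<Longrightarrow> \<exists>u\<in>G. s \<subseteq> u \<and> t \<subseteq> u"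
    "\<And>D'. D' \<in> D ` (\<B> \<times> UNIV) \<Longrightarrow> G \<inter> D' \<noteq> {}"
    using MA_countable_family[OF MA S S' dense sub few] by blast
  \<comment> \<open>By directedness a finite part of the generic set lies in one condition, so all
    finite partial sums over the image are bounded by 1.\<close>
  have dir: "\<exists>s\<in>G. T \<subseteq> s" if "finite T" "T \<subseteq> \<Union>G" for T
    using that
  proof (induction T rule: finite_induct)
    case empty
    then show ?case using G(2) by blast
  next
    case (insert x T)
    then obtain s s' where "s \<in> G" "T \<subseteq> s" "s' \<in> G" "x \<in> s'"
      by auto
    then show ?case
      using G(3)[of s s'] by blast
  qed
  show thesis
  proof
    show "F ` \<Union>G \<in> summable_ideal g"
      unfolding summable_ideal_def mem_Collect_eq
    proof (rule nonneg_bdd_above_summable_on)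
      show "bdd_above (sum g ` {X. X \<subseteq> F ` \<Union>G \<and> finite X})"
      proof (rule bdd_aboveI2)
        fix X assume "X \<in> {X. X \<subseteq> F ` \<Union>G \<and> finite X}"
        then obtain T where T: "finite T" "T \<subseteq> \<Union>G" "X = F ` T"
          by (metis (no_types, lifting) finite_subset_image mem_Collect_eq)
        then obtain s where s: "s \<in> G" "T \<subseteq> s"
          using dir by blast
        then have "finite s" "sum g (F ` s) < 1"
          using G(1) by (auto simp: S_def)
        moreover have "sum g X \<le> sum g (F ` s)"
          using T s \<open>finite s\<close> pos by (intro sum_mono2) (auto intro: less_imp_le)
        ultimately show "sum g X \<le> 1"
          by simp
      qed
    qed (use pos in \<open>auto intro: less_imp_le\<close>)
    show "large g (\<Union>G \<inter> B)" if B_in: "B \<in> \<B>" for B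
      unfolding large_def
    proof
      fix c
      obtain s where s: "s \<in> G" "s \<in> D (B, c)"
        using G(4)[of "D (B, c)"] B_in by blast
      then obtain k where k: "k \<ge> c" "level g k c \<le> card (s \<inter> B \<inter> {..<level g k k})"
        by (auto simp: D_def)
      have "card (s \<inter> B \<inter> {..<level g k k}) \<le> card (\<Union>G \<inter> B \<inter> {..<level g k k})"
        using s(1) by (intro card_mono) auto
      with k show "\<exists>k\<ge>c. level g k c \<le> card (\<Union>G \<inter> B \<inter> {..<level g k k})"
        by (meson le_trans)
    qed
  qed
qed

text \<open>A fibre compatible with the whole base is itself a suitable \<open>A\<close>, as its
  image has at most one point. If there is none, removing finitely many fibres keeps every base
  member large, as forcing requires.\<close>

lemma extend_base_small_image:
  fixes g :: "nat \<Rightarrow> real" and F :: "nat \<Rightarrow> nat" and \<B> :: "nat set set"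
  assumes MA: "MA_sigma_centered" and pos: "\<And>n. g n > 0" and lim: "g \<longlonglongrightarrow> 0"
    and small: "\<B> \<prec> (UNIV :: real set)"
    and Int: "\<And>B B'. B \<in> \<B> \<Longrightarrow> B' \<in> \<B> \<Longrightarrow> B \<inter> B' \<in> \<B>"
    and large: "\<And>B. B \<in> \<B> \<Longrightarrow> large g B"
  obtains A where "F ` A \<in> summable_ideal g" "\<And>B. B \<in> \<B> \<Longrightarrow> large g (A \<inter> B)"
proof (cases "\<exists>v. \<forall>B\<in>\<B>. large g (F -` {v} \<inter> B)")
  case True
  then show ?thesis
    using that summable_ideal_image_of_fibre by blast
next
  case False
  have "\<forall>B\<in>\<B>. large g (B - F -` K)" if "finite K" for K
    using that
  proof (induction K rule: finite_induct)
    case empty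
    then show ?case using large by simp
  next
    case (insert v K)
    show ?case
    proof
      fix B assume B: "B \<in> \<B>"
      obtain B' where B': "B' \<in> \<B>" "\<not> large g (F -` {v} \<inter> B')"
        using False by blast
      \<comment> \<open>The induction hypothesis is used for \<open>B \<inter> B'\<close>, where the
        fibre of \<open>v\<close> is not large; by \<open>large_Un\<close> the rest must be.\<close>
      have "large g (B \<inter> B' - F -` K)"
        using insert.IH Int B B'(1) by blast
      moreover have "B \<inter> B' - F -` K \<subseteq> (F -` {v} \<inter> B') \<union> (B - F -` insert v K)"
        by blast
      ultimately show "large g (B - F -` insert v K)"
        using B'(2) large_Un large_mono by blast
    qed
  qed
  then have all_large: "large g (B - F -` K)" if "B \<in> \<B>" "finite K" for B K
    using that by blast
  show ?thesis
    using generic_small_image[OF MA pos lim small all_large] that by blast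
qed

text \<open>If \<open>B\<close> and \<open>B'\<close> refuted the two halves of \<open>A\<close>,
  then \<open>A\<close> would not be large on \<open>B \<inter> B'\<close>, which is again in the
  base.\<close>

lemma extend_base:
  fixes g :: "nat \<Rightarrow> real" and F :: "nat \<Rightarrow> nat" and \<B> :: "nat set set"
  assumes MA: "MA_sigma_centered" and pos: "\<And>n. g n > 0" and lim: "g \<longlonglongrightarrow> 0"
    and small: "\<B> \<prec> (UNIV :: real set)"
    and Int: "\<And>B B'. B \<in> \<B> \<Longrightarrow> B' \<in> \<B> \<Longrightarrow> B \<inter> B' \<in> \<B>"
    and large: "\<And>B. B \<in> \<B> \<Longrightarrow> large g B"
  obtains A where "F ` A \<in> summable_ideal g" "A \<subseteq> Y \<or> A \<subseteq> - Y"
    "\<And>B. B \<in> \<B> \<Longrightarrow> large g (A \<inter> B)"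
proof -
  obtain A where A: "F ` A \<in> summable_ideal g" "\<And>B. B \<in> \<B> \<Longrightarrow> large g (A \<inter> B)"
    using extend_base_small_image[OF MA pos lim small Int large] by blast
  have sub: "F ` (A \<inter> Z) \<in> summable_ideal g" for Z
    using A(1) summable_on_subset_banach[of g "F ` A" "F ` (A \<inter> Z)"]
    by (auto simp: summable_ideal_def)
  have "(\<forall>B\<in>\<B>. large g (A \<inter> Y \<inter> B)) \<or> (\<forall>B\<in>\<B>. large g (A \<inter> - Y \<inter> B))"
  proof (rule ccontr)
    assume "\<not> ?thesis"
    then obtain B B' where B: "B \<in> \<B>" "\<not> large g (A \<inter> Y \<inter> B)" "B' \<in> \<B>" "\<not> large g (A \<inter> - Y \<inter> B')"
      by blast
    have "large g (A \<inter> (B \<inter> B'))"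
      using A(2) Int B by blast
    moreover have "A \<inter> (B \<inter> B') \<subseteq> (A \<inter> Y \<inter> B) \<union> (A \<inter> - Y \<inter> B')"
      by blast
    ultimately show False
      using B large_Un large_mono by blast
  qed
  then show ?thesis
    using that[of "A \<inter> Y"] that[of "A \<inter> - Y"] sub by blast
qed

subsection \<open>The transfinite construction\<close>

text \<open>The equality is a separate alternative because the lemma is applied to a strict
  order.\<close>

lemma finite_has_greatest:
  assumes "finite K" "K \<noteq> {}" "trans R" "total R"
  shows "\<exists>y\<in>K. \<forall>z\<in>K. z = y \<or> (z, y) \<in> R"
  using assms(1,2)
proof (induction K rule: finite_ne_induct)
  case (insert x K)
  then obtain y where y: "y \<in> K" "\<forall>z\<in>K. z = y \<or> (z, y) \<in> R"
    by blast
  then consider "x = y" | "(x, y) \<in> R" | "(y, x) \<in> R"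
    using assms(4) by (auto simp: total_on_def)
  then show ?case
  proof cases
    case 3
    then have "\<forall>z\<in>K. (z, x) \<in> R"
      using y assms(3) by (metis transD)
    then show ?thesis by blast
  qed (use y in blast)+
qed simp

text \<open>Deciding the zero set of every \<open>F\<close> decides every set of natural numbers, so the sets
  \<open>A F\<close> generate an ultrafilter.\<close>

lemma large_tower:
  fixes g :: "nat \<Rightarrow> real"
  assumes MA: "MA_sigma_centered" and pos: "\<And>n. g n > 0" and lim: "g \<longlonglongrightarrow> 0"
  obtains A :: "(nat \<Rightarrow> nat) \<Rightarrow> nat set"
  where "\<And>F. F ` A F \<in> summable_ideal g"
    and "\<And>F. A F \<subseteq> {n. F n = 0} \<or> A F \<subseteq> - {n. F n = 0}"
    and "\<And>K. finite K \<Longrightarrow> large g (\<Inter>F\<in>K. A F)"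
proof -
  \<comment> \<open>A cardinal order, so that each stage of the recursion has fewer than continuum
    many predecessors; \<open>R\<close> is its strict part.\<close>
  define r where "r = |UNIV :: (nat \<Rightarrow> nat) set|"
  have card: "Card_order r" and field: "Field r = UNIV" and wo: "Well_order r"
    unfolding r_def by (rule card_of_Card_order Field_card_of card_of_Well_order)+
  define R where "R = r - Id"
  have wf: "wf R"
    using wo by (simp add: R_def well_order_on_def)
  have "trans R" "total R"
    using wo field unfolding R_def well_order_on_def linear_order_on_def partial_order_on_def
      preorder_on_def
    by (auto intro: trans_diff_Id simp: total_on_diff_Id)
  \<comment> \<open>\<open>P f F A\<close> says that \<open>A\<close> is an admissible choice at
    stage \<open>F\<close>. It consults \<open>f\<close> only below \<open>F\<close>, as
    well-founded choice demands.\<close>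
  define P where "P f F A \<longleftrightarrow> F ` A \<in> summable_ideal g \<and>
      (A \<subseteq> {n. F n = 0} \<or> A \<subseteq> - {n. F n = 0}) \<and>
      (\<forall>K. finite K \<and> K \<subseteq> {G. (G, F) \<in> R} \<longrightarrow> large g (A \<inter> (\<Inter>G\<in>K. f G)))"
    for f :: "(nat \<Rightarrow> nat) \<Rightarrow> nat set" and F :: "nat \<Rightarrow> nat" and A
  have fip: "large g (\<Inter>F\<in>K. f F)" if K: "finite K" "\<And>F. F \<in> K \<Longrightarrow> P f F (f F)" for f K
  proof (cases "K = {}")
    case True
    then show ?thesis by (simp add: large_UNIV)
  next
    case False
    \<comment> \<open>Largeness of the whole intersection was secured at the last stage
      \<open>F\<close> occurring in \<open>K\<close>, with \<open>K - {F}\<close> as the finite set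
      of predecessors.\<close>
    then obtain F where F: "F \<in> K" "\<forall>G\<in>K. G = F \<or> (G, F) \<in> R"
      using finite_has_greatest[OF K(1) _ \<open>trans R\<close> \<open>total R\<close>] by blast
    then have "large g (f F \<inter> (\<Inter>G\<in>K - {F}. f G))"
      using K unfolding P_def by blast
    moreover have "f F \<inter> (\<Inter>G\<in>K - {F}. f G) = (\<Inter>G\<in>K. f G)"
      using F(1) by blast
    ultimately show ?thesis by simp
  qed
  have "\<exists>f. \<forall>F. P f F (f F)"
  proof (rule dependent_wf_choice[OF wf])
    fix f f' :: "(nat \<Rightarrow> nat) \<Rightarrow> nat set" and F A
    assume eq: "\<And>G. (G, F) \<in> R \<Longrightarrow> f G = f' G"
    have "(\<Inter>G\<in>K. f G) = (\<Inter>G\<in>K. f' G)" if "K \<subseteq> {G. (G, F) \<in> R}" for K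
      using that eq by blast
    then show "P f F A = P f' F A"
      unfolding P_def by auto
  next
    fix F and f :: "(nat \<Rightarrow> nat) \<Rightarrow> nat set"
    assume IH: "\<And>G. (G, F) \<in> R \<Longrightarrow> P f G (f G)"
    define X where "X = {G. (G, F) \<in> R}"
    define \<B> where "\<B> = (\<lambda>K. \<Inter>G\<in>K. f G) ` Fpow X"
    have "X = underS r F"
      by (auto simp: X_def R_def underS_def)
    then have "|X| <o r"
      using card_of_underS[OF card] field by simp
    then have "X \<prec> (UNIV :: (nat \<Rightarrow> nat) set)"
      by (simp add: r_def ordLess_imp_lesspoll)
    then have "X \<prec> (UNIV :: real set)"
      by (rule lesspoll_trans2[OF _ nat_fun_lepoll_real])
    then have few: "\<B> \<prec> (UNIV :: real set)"
      unfolding \<B>_def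
      by (intro lesspoll_trans1[OF image_lepoll] Fpow_lesspoll_uncountable uncountable_UNIV_real)
    have Int: "B \<inter> B' \<in> \<B>" if "B \<in> \<B>" "B' \<in> \<B>" for B B'
    proof -
      obtain K K' where "K \<in> Fpow X" "K' \<in> Fpow X" "B = (\<Inter>G\<in>K. f G)" "B' = (\<Inter>G\<in>K'. f G)"
        using \<open>B \<in> \<B>\<close> \<open>B' \<in> \<B>\<close> by (auto simp: \<B>_def)
      then have "K \<union> K' \<in> Fpow X" "B \<inter> B' = (\<Inter>G\<in>K \<union> K'. f G)"
        by (auto simp: Fpow_def)
      then show ?thesis
        by (auto simp: \<B>_def)
    qed
    have large: "large g B" if "B \<in> \<B>" for B
      using that fip IH by (auto simp: \<B>_def Fpow_def X_def subset_iff)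
    obtain A where "F ` A \<in> summable_ideal g" "A \<subseteq> {n. F n = 0} \<or> A \<subseteq> - {n. F n = 0}"
      "\<And>B. B \<in> \<B> \<Longrightarrow> large g (A \<inter> B)"
      using extend_base[OF MA pos lim few Int large] by blast
    then have "P f F A"
      by (auto simp: P_def \<B>_def Fpow_def X_def)
    then show "\<exists>A. P f F A" ..
  qed
  then obtain A where A: "\<And>F. P A F (A F)"
    by blast
  show thesis
  proof
    show "F ` A F \<in> summable_ideal g" "A F \<subseteq> {n. F n = 0} \<or> A F \<subseteq> - {n. F n = 0}" for F
      using A by (auto simp: P_def)
    show "large g (\<Inter>F\<in>K. A F)" if "finite K" for K
      using fip[OF that] A by blast
  qed
qed

theorem theorem3p4:
  fixes g :: "nat \<Rightarrow> real"
  assumes "MA_sigma_centered"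
    and "\<And>n. g n > 0"
    and "\<not> summable g"
    and "tall (summable_ideal g)"
  shows "\<exists>U :: nat filter.
           ideal_ultrafilter (summable_ideal g) U \<and> nonprincipal U \<and> \<not> rapid U"
proof -
  have lim: "g \<longlonglongrightarrow> 0"
    using tall_summable_ideal_iff assms(2,4) by blast
  obtain A :: "(nat \<Rightarrow> nat) \<Rightarrow> nat set"
    where small: "\<And>F. F ` A F \<in> summable_ideal g"
      and dec: "\<And>F. A F \<subseteq> {n. F n = 0} \<or> A F \<subseteq> - {n. F n = 0}"
      and fip: "\<And>K. finite K \<Longrightarrow> large g (\<Inter>F\<in>K. A F)"
    using large_tower[OF assms(1,2) lim] by blast
  define U where "U = (INF F. principal (A F))"
  have ev: "eventually P U \<longleftrightarrow> (\<exists>K. finite K \<and> (\<forall>x\<in>\<Inter>F\<in>K. A F. P x))" for P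
    unfolding U_def by (subst eventually_INF) (auto simp: INF_principal_finite eventually_principal)
  have mem: "X \<in> filter_sets U \<longleftrightarrow> (\<exists>K. finite K \<and> (\<Inter>F\<in>K. A F) \<subseteq> X)" for X
    by (auto simp: filter_sets_def ev subset_iff)
  \<comment> \<open>Largeness of all members yields properness, nonprincipality and the failure of
    rapidity.\<close>
  have large: "large g X" if "X \<in> filter_sets U" for X
    using that fip large_mono by (auto simp: mem)
  have gen: "X \<in> filter_sets U" if "A F \<subseteq> X" for F X
    using that by (auto simp: mem intro!: exI[of _ "{F}"])
  have "U \<noteq> bot"
  proof
    assume "U = bot"
    then have "{} \<in> filter_sets U"
      by (simp add: filter_sets_def)
    then show False
      using large not_large_empty by blast
  qed
  moreover have "X \<in> filter_sets U \<or> - X \<in> filter_sets U" for X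
  proof -
    define F :: "nat \<Rightarrow> nat" where "F n = (if n \<in> X then 0 else 1)" for n
    have "{n. F n = 0} = X"
      by (auto simp: F_def)
    then show ?thesis
      using dec[of F] gen by metis
  qed
  ultimately have "ideal_ultrafilter (summable_ideal g) U"
    unfolding ideal_ultrafilter_def ultrafilter_def using small gen by blast
  moreover have "nonprincipal U"
    using large not_large_singleton by (auto simp: nonprincipal_def)
  moreover have "\<not> rapid U"
  proof
    assume "rapid U"
    then obtain X where "X \<in> filter_sets U" "infinite X"
      "\<forall>\<^sub>F k in sequentially. level g k k \<le> enumerate X k"
      unfolding rapid_def dominating_def by (drule_tac x = "\<lambda>k. level g k k" in spec) blast
    then show False
      using large large_not_dominating by blast
  qed
  ultimately show ?thesis by blast
qed

end
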